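(* Let $\mathcal{L}$ be a countable first-order language and let $A\subseteq(0,1)$ be a countable set whose set $A'$ of limit points in $[0,1]$ satisfies $A'\subseteq\{0\}$. In the Gödel logic $\mathfrak{G}_{[0,1],A}$, every strongly consistent, deductively complete, deductively Henkin $\mathcal{L}$-theory is satisfiable.
   Context: Reversed semantics of Gödel logic: the logic $\mathfrak{G}_{[0,1],A}$ over $\mathcal{L}$ has connectives $\wedge,\to,\bot$, quantifiers $\forall,\exists$, and nullary connectives $\bar r$ for $r\in A$ ($\bar1$ is $\bot$, $\bar0$ available). Truth value $0$ is absolute truth and $1$ absolute falsity. A structure $\mathcal{M}$ has a nonempty universe $M$, predicates $P^{\mathcal M}:M^n\to[0,1]$, functions $M^n\to M$, constants in $M$. Interpretation: $\bot^{\mathcal M}=1$, $\bar r^{\mathcal M}=r$, $(\varphi\wedge\psi)^{\mathcal M}=\max(\varphi^{\mathcal M},\psi^{\mathcal M})$, $(\varphi\to\psi)^{\mathcal M}=\varphi^{\mathcal M}\dot\to\psi^{\mathcal M}$ where $x\dot\to y=0$ if $x\ge y$ and $=y$ if $x<y$, $\forall$ is interpreted by supremum and $\exists$ by infimum. $\neg\varphi:=\varphi\to\bot$, $\varphi\vee\psi:=((\varphi\to\psi)\to\psi)\wedge((\psi\to\varphi)\to\varphi)$, $\varphi\leftrightarrow\psi:=(\varphi\to\psi)\wedge(\psi\to\varphi)$. $\mathcal M\models\varphi$ (sentence) iff $\varphi^{\mathcal M}=0$; a theory (set of sentences) is satisfiable if some structure models all its members. Proof system: axioms (G1) $(\varphi\to\psi)\to((\psi\to\chi)\to(\varphi\to\chi))$;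 (G2) $(\varphi\wedge\psi)\to\varphi$; (G3) $(\varphi\wedge\psi)\to(\psi\wedge\varphi)$; (G4) $\varphi\to(\varphi\wedge\varphi)$; (G5) $(\varphi\to(\psi\to\chi))\leftrightarrow((\varphi\wedge\psi)\to\chi)$; (G6) $((\varphi\to\psi)\to\chi)\to(((\psi\to\varphi)\to\chi)\to\chi)$; (G7) $\bar1\to\varphi$; (G$\forall$1) $\forall x\varphi(x)\to\varphi(t)$; (G$\forall$2) $\forall x(\psi\to\varphi(x))\to(\psi\to\forall x\varphi(x))$, $x$ not free in $\psi$; (G$\forall$3) $\forall x(\psi\vee\varphi(x))\to(\psi\vee\forall x\varphi(x))$, $x$ not free in $\psi$; (G$\exists$1) $\varphi(t)\to\exists x\varphi(x)$; (G$\exists$2) $\forall x(\varphi(x)\to\psi)\to(\exists x\varphi(x)\to\psi)$, $x$ not free in $\psi$ ($t$ substitutable); for $r,s\in A\cup\{0,1\}$: (RG1) $(\bar r\wedge\bar s)\leftrightarrow\overline{\max\{r,s\}}$; (RG2a) $\bar r\to\bar s$ for $r\ge s$; (RG2b) $(\bar r\to\bar s)\leftrightarrow\bar s$ for $r<s$; (RG3) $\neg\neg\bar r$ for $r<1$; rules modus ponens and generalization. $T\vdash\varphi$ means a finite derivation from $T$ and the axioms. $T$ is strongly consistent if $T\nvdash\bar r$ for every $r\in A\cup\{1\}$. $T$ is deductively complete if for every pair of $\mathcal L$-sentences $\varphi,\psi$, $T\vdash\varphi\to\psi$ or $T\vdash\psi\to\varphi$. $T$ is deductively Henkin if for every $\mathcal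 L$-sentence $\forall x\,\varphi(x)$ with $T\nvdash\forall x\,\varphi(x)$ there is a constant symbol $c$ of $\mathcal L$ with $T\nvdash\varphi(c)$. *)

theory Defs
  imports "HOL-Analysis.Analysis" "HOL-Library.Infinite_Typeclass"
begin

section \<open>Languages, terms and formulas\<close>

text \<open>Constant symbols are the function symbols of arity 0.\<close>

record ('f, 'p) language =
  funs :: "'f set"
  fun_arity :: "'f \<Rightarrow> nat"
  preds :: "'p set"
  pred_arity :: "'p \<Rightarrow> nat"

definition countable_language :: "('f, 'p) language \<Rightarrow> bool" where
  "countable_language L \<longleftrightarrow> countable (funs L) \<and> countable (preds L)"

definition constants :: "('f, 'p) language \<Rightarrow> 'f set" where
  "constants L = {c \<in> funs L. fun_arity L c = 0}"

datatype 'f tm = Var nat | Fun 'f "'f tm list"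

text \<open>\<open>Tr r\<close> is the nullary connective of the truth value \<open>r\<close>. The formulas over \<open>L\<close> and \<open>A\<close> are
  those in which only \<open>Tr r\<close> with \<open>r \<in> A \<union> {0, 1}\<close> occur, see \<open>wf_fm\<close>.\<close>

datatype ('f, 'p) fm =
    Tr real
  | Pred 'p "'f tm list"
  | Conj "('f, 'p) fm" "('f, 'p) fm"
  | Imp "('f, 'p) fm" "('f, 'p) fm"
  | All nat "('f, 'p) fm"
  | Ex nat "('f, 'p) fm"

abbreviation Bot :: "('f, 'p) fm" where
  "Bot \<equiv> Tr 1"

abbreviation Neg :: "('f, 'p) fm \<Rightarrow> ('f, 'p) fm" where
  "Neg \<phi> \<equiv> Imp \<phi> Bot"

abbreviation Disj :: "('f, 'p) fm \<Rightarrow> ('f, 'p) fm \<Rightarrow> ('f, 'p) fm" where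
  "Disj \<phi> \<psi> \<equiv> Conj (Imp (Imp \<phi> \<psi>) \<psi>) (Imp (Imp \<psi> \<phi>) \<phi>)"

abbreviation Iff :: "('f, 'p) fm \<Rightarrow> ('f, 'p) fm \<Rightarrow> ('f, 'p) fm" where
  "Iff \<phi> \<psi> \<equiv> Conj (Imp \<phi> \<psi>) (Imp \<psi> \<phi>)"

fun wf_tm :: "('f, 'p) language \<Rightarrow> 'f tm \<Rightarrow> bool" where
  "wf_tm L (Var x) \<longleftrightarrow> True"
| "wf_tm L (Fun f ts) \<longleftrightarrow>
     f \<in> funs L \<and> length ts = fun_arity L f \<and> (\<forall>t \<in> set ts. wf_tm L t)"

fun wf_fm :: "('f, 'p) language \<Rightarrow> real set \<Rightarrow> ('f, 'p) fm \<Rightarrow> bool" where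
  "wf_fm L A (Tr r) \<longleftrightarrow> r \<in> A \<union> {0, 1}"
| "wf_fm L A (Pred P ts) \<longleftrightarrow>
     P \<in> preds L \<and> length ts = pred_arity L P \<and> (\<forall>t \<in> set ts. wf_tm L t)"
| "wf_fm L A (Conj \<phi> \<psi>) \<longleftrightarrow> wf_fm L A \<phi> \<and> wf_fm L A \<psi>"
| "wf_fm L A (Imp \<phi> \<psi>) \<longleftrightarrow> wf_fm L A \<phi> \<and> wf_fm L A \<psi>"
| "wf_fm L A (All x \<phi>) \<longleftrightarrow> wf_fm L A \<phi>"
| "wf_fm L A (Ex x \<phi>) \<longleftrightarrow> wf_fm L A \<phi>"

fun vars_tm :: "'f tm \<Rightarrow> nat set" where
  "vars_tm (Var x) = {x}"
| "vars_tm (Fun f ts) = (\<Union>t \<in> set ts. vars_tm t)"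

fun free_vars :: "('f, 'p) fm \<Rightarrow> nat set" where
  "free_vars (Tr r) = {}"
| "free_vars (Pred P ts) = (\<Union>t \<in> set ts. vars_tm t)"
| "free_vars (Conj \<phi> \<psi>) = free_vars \<phi> \<union> free_vars \<psi>"
| "free_vars (Imp \<phi> \<psi>) = free_vars \<phi> \<union> free_vars \<psi>"
| "free_vars (All x \<phi>) = free_vars \<phi> - {x}"
| "free_vars (Ex x \<phi>) = free_vars \<phi> - {x}"

definition is_sentence :: "('f, 'p) language \<Rightarrow> real set \<Rightarrow> ('f, 'p) fm \<Rightarrow> bool" where
  "is_sentence L A \<phi> \<longleftrightarrow> wf_fm L A \<phi> \<and> free_vars \<phi> = {}"

definition is_theory :: "('f, 'p) language \<Rightarrow> real set \<Rightarrow> ('f, 'p) fm set \<Rightarrow> bool" where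
  "is_theory L A T \<longleftrightarrow> (\<forall>\<phi> \<in> T. is_sentence L A \<phi>)"

fun subst_tm :: "nat \<Rightarrow> 'f tm \<Rightarrow> 'f tm \<Rightarrow> 'f tm" where
  "subst_tm x t (Var y) = (if y = x then t else Var y)"
| "subst_tm x t (Fun f ts) = Fun f (map (subst_tm x t) ts)"

text \<open>\<open>subst x t \<phi>\<close> replaces the free occurrences of \<open>x\<close> in \<open>\<phi>\<close> by \<open>t\<close> without renaming bound
  variables; it is only meaningful if \<open>substitutable x t \<phi>\<close>.\<close>

fun subst :: "nat \<Rightarrow> 'f tm \<Rightarrow> ('f, 'p) fm \<Rightarrow> ('f, 'p) fm" where
  "subst x t (Tr r) = Tr r"
| "subst x t (Pred P ts) = Pred P (map (subst_tm x t) ts)"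
| "subst x t (Conj \<phi> \<psi>) = Conj (subst x t \<phi>) (subst x t \<psi>)"
| "subst x t (Imp \<phi> \<psi>) = Imp (subst x t \<phi>) (subst x t \<psi>)"
| "subst x t (All y \<phi>) = All y (if y = x then \<phi> else subst x t \<phi>)"
| "subst x t (Ex y \<phi>) = Ex y (if y = x then \<phi> else subst x t \<phi>)"

fun substitutable :: "nat \<Rightarrow> 'f tm \<Rightarrow> ('f, 'p) fm \<Rightarrow> bool" where
  "substitutable x t (Tr r) \<longleftrightarrow> True"
| "substitutable x t (Pred P ts) \<longleftrightarrow> True"
| "substitutable x t (Conj \<phi> \<psi>) \<longleftrightarrow> substitutable x t \<phi> \<and> substitutable x t \<psi>"
| "substitutable x t (Imp \<phi> \<psi>) \<longleftrightarrow> substitutable x t \<phi> \<and> substitutable x t \<psi>"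
| "substitutable x t (All y \<phi>) \<longleftrightarrow>
     x \<notin> free_vars (All y \<phi>) \<or> y \<notin> vars_tm t \<and> substitutable x t \<phi>"
| "substitutable x t (Ex y \<phi>) \<longleftrightarrow>
     x \<notin> free_vars (Ex y \<phi>) \<or> y \<notin> vars_tm t \<and> substitutable x t \<phi>"


section \<open>Structures and (reversed) semantics\<close>

text \<open>0 is absolute truth and 1 is absolute falsity.\<close>

record ('u, 'f, 'p) struct =
  univ :: "'u set"
  fun_int :: "'f \<Rightarrow> 'u list \<Rightarrow> 'u"
  pred_int :: "'p \<Rightarrow> 'u list \<Rightarrow> real"

definition is_structure :: "('f, 'p) language \<Rightarrow> ('u, 'f, 'p) struct \<Rightarrow> bool" where
  "is_structure L M \<longleftrightarrow>
     univ M \<noteq> {} \<and>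
     (\<forall>f \<in> funs L. \<forall>us. length us = fun_arity L f \<and> set us \<subseteq> univ M \<longrightarrow> fun_int M f us \<in> univ M) \<and>
     (\<forall>P \<in> preds L. \<forall>us. length us = pred_arity L P \<and> set us \<subseteq> univ M \<longrightarrow> pred_int M P us \<in> {0..1})"

definition gimp :: "real \<Rightarrow> real \<Rightarrow> real" where
  "gimp x y = (if x \<ge> y then 0 else y)"

fun eval_tm :: "('u, 'f, 'p) struct \<Rightarrow> (nat \<Rightarrow> 'u) \<Rightarrow> 'f tm \<Rightarrow> 'u" where
  "eval_tm M e (Var x) = e x"
| "eval_tm M e (Fun f ts) = fun_int M f (map (eval_tm M e) ts)"

text \<open>For a structure \<open>M\<close>, a formula of the language and an assignment into \<open>univ M\<close>, all values lie
  in \<open>{0..1}\<close> (see \<open>eval_in_unit\<close> below), so that the suprema and infima are those of \<open>{0..1}\<close>.\<close>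

fun eval :: "('u, 'f, 'p) struct \<Rightarrow> (nat \<Rightarrow> 'u) \<Rightarrow> ('f, 'p) fm \<Rightarrow> real" where
  "eval M e (Tr r) = r"
| "eval M e (Pred P ts) = pred_int M P (map (eval_tm M e) ts)"
| "eval M e (Conj \<phi> \<psi>) = max (eval M e \<phi>) (eval M e \<psi>)"
| "eval M e (Imp \<phi> \<psi>) = gimp (eval M e \<phi>) (eval M e \<psi>)"
| "eval M e (All x \<phi>) = (SUP a \<in> univ M. eval M (e(x := a)) \<phi>)"
| "eval M e (Ex x \<phi>) = (INF a \<in> univ M. eval M (e(x := a)) \<phi>)"

text \<open>The value of a sentence does not depend on the assignment (see \<open>eval_cong\<close> below).\<close>

definition models :: "('u, 'f, 'p) struct \<Rightarrow> ('f, 'p) fm \<Rightarrow> bool" where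
  "models M \<phi> \<longleftrightarrow> (\<forall>e. range e \<subseteq> univ M \<longrightarrow> eval M e \<phi> = 0)"

text \<open>HOL cannot quantify existentially over types, so the type \<open>'u\<close> that the universe is a subset of
  is a parameter. For a countable language and an infinite type \<open>'u\<close> this is no restriction: by the
  downward Loewenheim-Skolem argument a theory with any model at all has a countable one, which
  embeds into \<open>'u\<close>.\<close>

definition satisfiable :: "'u itself \<Rightarrow> ('f, 'p) language \<Rightarrow> ('f, 'p) fm set \<Rightarrow> bool" where
  "satisfiable (_ :: 'u itself) L T \<longleftrightarrow>
     (\<exists>M :: ('u, 'f, 'p) struct. is_structure L M \<and> (\<forall>\<phi> \<in> T. models M \<phi>))"

lemma eval_tm_in_univ:
  assumes "is_structure L M" "range e \<subseteq> univ M" "wf_tm L t"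
  shows "eval_tm M e t \<in> univ M"
  using assms(3)
proof (induction t)
  case (Var x)
  then show ?case using assms(2) by auto
next
  case (Fun f ts)
  then have "set (map (eval_tm M e) ts) \<subseteq> univ M" by auto
  then show ?case
    using Fun.prems assms(1) unfolding is_structure_def eval_tm.simps
    by (metis length_map wf_tm.simps(2))
qed

lemma eval_in_unit:
  assumes "is_structure L M" "A \<subseteq> {0..1}"
  shows "wf_fm L A \<phi> \<Longrightarrow> range e \<subseteq> univ M \<Longrightarrow> eval M e \<phi> \<in> {0..1}"
proof (induction \<phi> arbitrary: e)
  case (Tr r)
  then show ?case using assms(2) by auto
next
  case (Pred P ts)
  then have "set (map (eval_tm M e) ts) \<subseteq> univ M"
    using eval_tm_in_univ[OF assms(1)] by auto
  then show ?case
    using Pred.prems(1) assms(1) unfolding is_structure_def eval.simps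
    by (metis length_map wf_fm.simps(2))
next
  case (Conj \<phi> \<psi>)
  then show ?case by (auto simp: max_def)
next
  case (Imp \<phi> \<psi>)
  then show ?case by (auto simp: gimp_def)
next
  case (All x \<phi>)
  have ne: "univ M \<noteq> {}" using assms(1) by (simp add: is_structure_def)
  have b: "eval M (e(x := a)) \<phi> \<in> {0..1}" if "a \<in> univ M" for a
    using All that by (intro All.IH) auto
  obtain a where a: "a \<in> univ M" using ne by blast
  have "eval M (e(x := a)) \<phi> \<le> (SUP a \<in> univ M. eval M (e(x := a)) \<phi>)"
    using a b by (intro cSUP_upper) (auto intro!: bdd_aboveI2)
  moreover have "(SUP a \<in> univ M. eval M (e(x := a)) \<phi>) \<le> 1"
    using ne b by (intro cSUP_least) auto
  ultimately show ?case using b[OF a] by auto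
next
  case (Ex x \<phi>)
  have ne: "univ M \<noteq> {}" using assms(1) by (simp add: is_structure_def)
  have b: "eval M (e(x := a)) \<phi> \<in> {0..1}" if "a \<in> univ M" for a
    using Ex that by (intro Ex.IH) auto
  obtain a where a: "a \<in> univ M" using ne by blast
  have "(INF a \<in> univ M. eval M (e(x := a)) \<phi>) \<le> eval M (e(x := a)) \<phi>"
    using a b by (intro cINF_lower) (auto intro!: bdd_belowI2)
  moreover have "0 \<le> (INF a \<in> univ M. eval M (e(x := a)) \<phi>)"
    using ne b by (intro cINF_greatest) auto
  ultimately show ?case using b[OF a] by auto
qed

lemma eval_tm_cong:
  "(\<And>x. x \<in> vars_tm t \<Longrightarrow> e x = e' x) \<Longrightarrow> eval_tm M e t = eval_tm M e' t"
proof (induction t)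
  case (Fun f ts)
  have "map (eval_tm M e) ts = map (eval_tm M e') ts"
    using Fun by (auto intro!: Fun.IH)
  then show ?case by (metis eval_tm.simps(2))
qed simp

lemma eval_cong:
  "(\<And>x. x \<in> free_vars \<phi> \<Longrightarrow> e x = e' x) \<Longrightarrow> eval M e \<phi> = eval M e' \<phi>"
proof (induction \<phi> arbitrary: e e')
  case (Pred P ts)
  then have "map (eval_tm M e) ts = map (eval_tm M e') ts"
    by (auto intro!: eval_tm_cong)
  then show ?case by (metis eval.simps(2))
next
  case (Conj \<phi> \<psi>)
  have "eval M e \<phi> = eval M e' \<phi>" "eval M e \<psi> = eval M e' \<psi>"
    using Conj.prems by (auto intro: Conj.IH)
  then show ?case by simp
next
  case (Imp \<phi> \<psi>)
  have "eval M e \<phi> = eval M e' \<phi>" "eval M e \<psi> = eval M e' \<psi>"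
    using Imp.prems by (auto intro: Imp.IH)
  then show ?case by simp
next
  case (All x \<phi>)
  have "eval M (e(x := a)) \<phi> = eval M (e'(x := a)) \<phi>" for a
    using All.prems by (intro All.IH) auto
  then show ?case by simp
next
  case (Ex x \<phi>)
  have "eval M (e(x := a)) \<phi> = eval M (e'(x := a)) \<phi>" for a
    using Ex.prems by (intro Ex.IH) auto
  then show ?case by simp
qed simp


section \<open>Proof system\<close>

inductive is_axiom :: "real set \<Rightarrow> ('f, 'p) fm \<Rightarrow> bool" for A where
  G1: "is_axiom A (Imp (Imp \<phi> \<psi>) (Imp (Imp \<psi> \<theta>) (Imp \<phi> \<theta>)))"
| G2: "is_axiom A (Imp (Conj \<phi> \<psi>) \<phi>)"
| G3: "is_axiom A (Imp (Conj \<phi> \<psi>) (Conj \<psi> \<phi>))"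
| G4: "is_axiom A (Imp \<phi> (Conj \<phi> \<phi>))"
| G5: "is_axiom A (Iff (Imp \<phi> (Imp \<psi> \<theta>)) (Imp (Conj \<phi> \<psi>) \<theta>))"
| G6: "is_axiom A (Imp (Imp (Imp \<phi> \<psi>) \<theta>) (Imp (Imp (Imp \<psi> \<phi>) \<theta>) \<theta>))"
| G7: "is_axiom A (Imp (Tr 1) \<phi>)"
| GAll1: "substitutable x t \<phi> \<Longrightarrow> is_axiom A (Imp (All x \<phi>) (subst x t \<phi>))"
| GAll2: "x \<notin> free_vars \<psi> \<Longrightarrow> is_axiom A (Imp (All x (Imp \<psi> \<phi>)) (Imp \<psi> (All x \<phi>)))"
| GAll3: "x \<notin> free_vars \<psi> \<Longrightarrow> is_axiom A (Imp (All x (Disj \<psi> \<phi>)) (Disj \<psi> (All x \<phi>)))"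
| GEx1: "substitutable x t \<phi> \<Longrightarrow> is_axiom A (Imp (subst x t \<phi>) (Ex x \<phi>))"
| GEx2: "x \<notin> free_vars \<psi> \<Longrightarrow> is_axiom A (Imp (All x (Imp \<phi> \<psi>)) (Imp (Ex x \<phi>) \<psi>))"
| RG1: "r \<in> A \<union> {0, 1} \<Longrightarrow> s \<in> A \<union> {0, 1} \<Longrightarrow>
    is_axiom A (Iff (Conj (Tr r) (Tr s)) (Tr (max r s)))"
| RG2a: "r \<in> A \<union> {0, 1} \<Longrightarrow> s \<in> A \<union> {0, 1} \<Longrightarrow> r \<ge> s \<Longrightarrow>
    is_axiom A (Imp (Tr r) (Tr s))"
| RG2b: "r \<in> A \<union> {0, 1} \<Longrightarrow> s \<in> A \<union> {0, 1} \<Longrightarrow> r < s \<Longrightarrow>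
    is_axiom A (Iff (Imp (Tr r) (Tr s)) (Tr s))"
| RG3: "r \<in> A \<union> {0, 1} \<Longrightarrow> r < 1 \<Longrightarrow> is_axiom A (Neg (Neg (Tr r)))"

text \<open>Every formula occurring in a derivation is required to be a formula over \<open>L\<close> and \<open>A\<close>. In
  \<open>GAll1\<close> and \<open>GEx1\<close> the term \<open>t\<close> is thereby an \<open>L\<close>-term whenever it occurs in the axiom at all.\<close>

inductive derives ::
  "('f, 'p) language \<Rightarrow> real set \<Rightarrow> ('f, 'p) fm set \<Rightarrow> ('f, 'p) fm \<Rightarrow> bool"
  for L A T where
  Hyp: "\<phi> \<in> T \<Longrightarrow> wf_fm L A \<phi> \<Longrightarrow> derives L A T \<phi>"
| Ax: "is_axiom A \<phi> \<Longrightarrow> wf_fm L A \<phi> \<Longrightarrow> derives L A T \<phi>"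
| MP: "derives L A T \<phi> \<Longrightarrow> derives L A T (Imp \<phi> \<psi>) \<Longrightarrow> derives L A T \<psi>"
| Gen: "derives L A T \<phi> \<Longrightarrow> derives L A T (All x \<phi>)"

definition strongly_consistent ::
  "('f, 'p) language \<Rightarrow> real set \<Rightarrow> ('f, 'p) fm set \<Rightarrow> bool" where
  "strongly_consistent L A T \<longleftrightarrow> (\<forall>r \<in> A \<union> {1}. \<not> derives L A T (Tr r))"

definition deductively_complete ::
  "('f, 'p) language \<Rightarrow> real set \<Rightarrow> ('f, 'p) fm set \<Rightarrow> bool" where
  "deductively_complete L A T \<longleftrightarrow>
     (\<forall>\<phi> \<psi>. is_sentence L A \<phi> \<and> is_sentence L A \<psi> \<longrightarrow>
        derives L A T (Imp \<phi> \<psi>) \<or> derives L A T (Imp \<psi> \<phi>))"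

definition deductively_henkin ::
  "('f, 'p) language \<Rightarrow> real set \<Rightarrow> ('f, 'p) fm set \<Rightarrow> bool" where
  "deductively_henkin L A T \<longleftrightarrow>
     (\<forall>x \<phi>. is_sentence L A (All x \<phi>) \<and> \<not> derives L A T (All x \<phi>) \<longrightarrow>
        (\<exists>c \<in> constants L. \<not> derives L A T (subst x (Fun c []) \<phi>)))"

end

theory Submission
  imports Defs
begin

text \<open>Order the sentences by \<open>\<phi> \<le> \<psi>\<close> iff \<open>T \<turnstile> \<psi> \<rightarrow> \<phi>\<close>. By completeness this is a total preorder,
  in which conjunction is the maximum, \<open>\<phi> \<rightarrow> \<psi>\<close> is provable or equivalent to \<open>\<psi>\<close>, and, by the Henkin
  property, quantified sentences are the suprema and infima of their closed instances. Strong
  consistency makes the order of the truth constants that of the reals. It remains to map this countable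
  preorder monotonically into \<open>[0, 1]\<close> such that each \<open>Tr r\<close> goes to \<open>r\<close>, existing suprema and infima
  are preserved, and elements with different positions are only identified at the value 0; the
  closed terms then form a model. Such a map sends the n-th element to the midpoint between the
  closest values forced from below and from above by truth constants and by earlier elements.
  A supremum or infimum is preserved because later elements halve any remaining distance to it, unless
  truth constants intervene, and these accumulate only at 0. Everything below all positive truth
  constants may have to collapse to 0.\<close>

section \<open>Embedding countable preorders with marked points\<close>

locale marked_preorder =
  fixes le :: "nat \<Rightarrow> nat \<Rightarrow> bool" (infix "\<preceq>" 50)
    and C :: "real set" and mark :: "real \<Rightarrow> nat"
  assumes le_total: "i \<preceq> j \<or> j \<preceq> i"
    and le_trans: "i \<preceq> j \<Longrightarrow> j \<preceq> k \<Longrightarrow> i \<preceq> k"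
    and C_unit: "C \<subseteq> {0..1}" and zero_in_C: "0 \<in> C" and one_in_C: "1 \<in> C"
    and C_islimpt: "x \<in> {0..1} \<Longrightarrow> x islimpt C \<Longrightarrow> x = 0"
    and mark_le_mark: "r \<in> C \<Longrightarrow> s \<in> C \<Longrightarrow> mark r \<preceq> mark s \<longleftrightarrow> r \<le> s"
    and le_mark_one: "n \<preceq> mark 1"
begin

lemma le_refl: "i \<preceq> i"
  using le_total by blast

lemma C_bounds: "r \<in> C \<Longrightarrow> 0 \<le> r" "r \<in> C \<Longrightarrow> r \<le> 1"
  using C_unit by auto

lemma bdd_C: "X \<subseteq> C \<Longrightarrow> bdd_above X" "X \<subseteq> C \<Longrightarrow> bdd_below X"
  by (meson C_bounds bdd_aboveI subsetD) (meson C_bounds bdd_belowI subsetD)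

text \<open>An unattained supremum would be a limit point of \<open>C\<close> in the unit interval,
  hence 0; but nonnegative numbers with supremum 0 attain it.\<close>

lemma Sup_in_C:
  assumes "X \<subseteq> C" "X \<noteq> {}"
  shows "Sup X \<in> X"
proof (rule ccontr)
  assume n: "Sup X \<notin> X"
  have "Sup X \<in> closure X"
    using assms bdd_C by (intro closure_contains_Sup) auto
  then have "Sup X islimpt C"
    using n assms(1) islimpt_subset by (auto simp: closure_def)
  moreover obtain x where x: "x \<in> X" using assms by blast
  have "x \<le> Sup X" using x assms bdd_C by (intro cSup_upper) auto
  moreover have "Sup X \<le> 1"
    using assms C_bounds by (intro cSup_least) auto
  moreover have "0 \<le> x" using x assms C_bounds by auto
  ultimately have "Sup X = 0" using C_islimpt[of "Sup X"] by auto
  then show False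
    using n x \<open>x \<le> Sup X\<close> \<open>0 \<le> x\<close> by auto
qed

text \<open>Dual to \<open>Sup_in_C\<close>, except that truth constants may decrease to an
  unattained infimum 0.\<close>

lemma Inf_in_C:
  assumes "X \<subseteq> C" "X \<noteq> {}" "Inf X \<noteq> 0"
  shows "Inf X \<in> X"
proof (rule ccontr)
  assume n: "Inf X \<notin> X"
  have "Inf X \<in> closure X"
    using assms bdd_C by (intro closure_contains_Inf) auto
  then have "Inf X islimpt C"
    using n assms(1) islimpt_subset by (auto simp: closure_def)
  moreover obtain x where x: "x \<in> X" using assms by blast
  have "Inf X \<le> x" using x assms bdd_C by (intro cInf_lower) auto
  moreover have "0 \<le> Inf X"
    using assms C_bounds by (intro cInf_greatest) auto
  moreover have "x \<le> 1" using x assms C_bounds by auto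
  ultimately show False using C_islimpt[of "Inf X"] assms(3) by auto
qed

text \<open>\<open>mark 0\<close> need not be a least element: the axioms do not prove \<open>Tr 0\<close>, so provable sentences may
  lie strictly below it. Hence the disjunct \<open>r = 0\<close>.\<close>

definition lower :: "nat \<Rightarrow> real" where
  "lower n = Sup {r \<in> C. r = 0 \<or> mark r \<preceq> n}"

definition upper :: "nat \<Rightarrow> real" where
  "upper n = Inf {r \<in> C. n \<preceq> mark r}"

lemma lower_in: "lower n \<in> C" "lower n = 0 \<or> mark (lower n) \<preceq> n"
  using Sup_in_C[of "{r \<in> C. r = 0 \<or> mark r \<preceq> n}"] zero_in_C
  unfolding lower_def by auto

text \<open>If the constants above \<open>n\<close> accumulate at 0, then \<open>upper n\<close> is
  0 although \<open>n\<close> may lie strictly above \<open>mark 0\<close>. This is the source of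
  the collapse at 0 and of the positivity assumptions below.\<close>

lemma upper_in:
  assumes "upper n \<noteq> 0"
  shows "upper n \<in> C" "n \<preceq> mark (upper n)"
  using Inf_in_C[of "{r \<in> C. n \<preceq> mark r}"] one_in_C le_mark_one assms
  unfolding upper_def by auto

lemma le_lower: "r \<in> C \<Longrightarrow> mark r \<preceq> n \<Longrightarrow> r \<le> lower n"
  unfolding lower_def by (intro cSup_upper bdd_C) auto

lemma upper_le: "r \<in> C \<Longrightarrow> n \<preceq> mark r \<Longrightarrow> upper n \<le> r"
  unfolding upper_def by (intro cInf_lower bdd_C) auto

lemma le_upperI: "(\<And>r. r \<in> C \<Longrightarrow> n \<preceq> mark r \<Longrightarrow> x \<le> r) \<Longrightarrow> x \<le> upper n"
  unfolding upper_def using one_in_C le_mark_one by (intro cInf_greatest) auto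

lemma lower_nonneg: "0 \<le> lower n"
  using C_bounds lower_in(1) by blast

lemma lower_le_mark: "r \<in> C \<Longrightarrow> n \<preceq> mark r \<Longrightarrow> lower n \<le> r"
  using lower_in[of n] C_bounds mark_le_mark le_trans by metis

lemma lower_le_upper: "lower n \<le> upper n"
  by (intro le_upperI lower_le_mark)

lemma upper_mono: "i \<preceq> j \<Longrightarrow> upper i \<le> upper j"
  by (intro le_upperI upper_le) (auto intro: le_trans)

lemma lower_mono: "i \<preceq> j \<Longrightarrow> lower i \<le> lower j"
  using lower_in[of i] lower_nonneg le_lower le_trans by metis

section \<open>Midpoint construction of the monotone map\<close>

fun emb :: "nat \<Rightarrow> real" where
  "emb n = (Max (insert (lower n) (emb ` {i. i < n \<and> i \<preceq> n})) +
              Min (insert (upper n) (emb ` {i. i < n \<and> n \<preceq> i}))) / 2"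

declare emb.simps [simp del]

definition lo :: "nat \<Rightarrow> real" where
  "lo n = Max (insert (lower n) (emb ` {i. i < n \<and> i \<preceq> n}))"

definition hi :: "nat \<Rightarrow> real" where
  "hi n = Min (insert (upper n) (emb ` {i. i < n \<and> n \<preceq> i}))"

lemma emb_eq: "emb n = (lo n + hi n) / 2"
  by (subst emb.simps) (simp add: lo_def hi_def)

lemma lower_le_lo: "lower n \<le> lo n"
  and emb_le_lo: "i < n \<Longrightarrow> i \<preceq> n \<Longrightarrow> emb i \<le> lo n"
  and hi_le_upper: "hi n \<le> upper n"
  and hi_le_emb: "i < n \<Longrightarrow> n \<preceq> i \<Longrightarrow> hi n \<le> emb i"
  by (auto simp: lo_def hi_def)

lemma lo_cases:
  obtains "lo n = lower n" | i where "i < n" "i \<preceq> n" "lo n = emb i"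
  using Max_in[of "insert (lower n) (emb ` {i. i < n \<and> i \<preceq> n})"]
  unfolding lo_def by auto

lemma hi_cases:
  obtains "hi n = upper n" | i where "i < n" "n \<preceq> i" "hi n = emb i"
  using Min_in[of "insert (upper n) (emb ` {i. i < n \<and> n \<preceq> i})"]
  unfolding hi_def by auto

text \<open>Both claims are proved jointly: \<open>lo n \<le> hi n\<close> compares every candidate
  from below with every candidate from above, and two earlier elements compare only if
  \<open>emb\<close> is already monotone among them.\<close>

lemma emb_invariant:
  "lo n \<le> hi n \<and> (\<forall>i < n. (i \<preceq> n \<longrightarrow> emb i \<le> emb n) \<and> (n \<preceq> i \<longrightarrow> emb n \<le> emb i))"
proof (induction n rule: less_induct)
  case (less n)
  have bnd: "lower i \<le> emb i" "emb i \<le> upper i" if "i < n" for i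
    using less[OF that] lower_le_lo[of i] hi_le_upper[of i] by (auto simp: emb_eq)
  \<comment> \<open>For distinct indices the induction hypothesis at the larger one applies.\<close>
  have mono: "emb i \<le> emb j" if "i < n" "j < n" "i \<preceq> j" for i j
    using less that by (metis linorder_neqE_nat order_refl)
  have "lo n \<le> hi n"
  proof (cases rule: lo_cases[of n])
    case 1
    then show ?thesis
      using lower_le_upper bnd(1) lower_mono by (cases rule: hi_cases[of n]) (metis, metis order_trans)
  next
    case (2 i)
    then show ?thesis
      using mono bnd(2) upper_mono le_trans by (cases rule: hi_cases[of n]) (metis order_trans, metis)
  qed
  then show ?case
    using emb_le_lo hi_le_emb by (fastforce simp: emb_eq[of n])
qed

lemma lo_le_emb: "lo n \<le> emb n" and emb_le_hi: "emb n \<le> hi n"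
  using emb_invariant[of n] by (auto simp: emb_eq)

lemma lower_le_emb: "lower n \<le> emb n" and emb_le_upper: "emb n \<le> upper n"
  using lo_le_emb lower_le_lo emb_le_hi hi_le_upper order_trans by blast+

lemma emb_nonneg: "0 \<le> emb n"
  using lower_nonneg lower_le_emb order_trans by blast

lemma emb_mono: "i \<preceq> j \<Longrightarrow> emb i \<le> emb j"
  using emb_invariant by (metis linorder_neqE_nat order_refl)

lemma emb_mark: "r \<in> C \<Longrightarrow> emb (mark r) = r"
  using le_lower upper_le lower_le_emb emb_le_upper le_refl by (meson order_antisym order_trans)

text \<open>The midpoint stays below \<open>r\<close> because \<open>hi n \<le> r\<close> and
  \<open>lo n < r\<close>. Positivity of \<open>r\<close> excludes the default value 0 of
  \<open>lower n\<close>, whose mark need not lie below \<open>n\<close>.\<close>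

lemma emb_less_mark:
  "r \<in> C \<Longrightarrow> 0 < r \<Longrightarrow> \<not> mark r \<preceq> n \<Longrightarrow> emb n < r"
proof (induction n rule: less_induct)
  case (less n)
  have "hi n \<le> r"
    using less.prems hi_le_upper upper_le le_total order_trans by metis
  moreover have "lo n < r"
  proof (cases rule: lo_cases[of n])
    case 1
    then show ?thesis
      using lower_in[of n] lower_le_mark[of r n] less.prems le_total by (metis order_less_le)
  next
    case (2 i)
    then show ?thesis using less le_trans by metis
  qed
  ultimately show ?case by (simp add: emb_eq)
qed

text \<open>Dual to \<open>emb_less_mark\<close>. Positivity of \<open>emb n\<close> passes to
  \<open>upper n\<close>, which is therefore attained.\<close>

lemma mark_less_emb:
  "r \<in> C \<Longrightarrow> \<not> n \<preceq> mark r \<Longrightarrow> 0 < emb n \<Longrightarrow> r < emb n"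
proof (induction n rule: less_induct)
  case (less n)
  have "r \<le> lo n"
    using less.prems lower_le_lo le_lower le_total order_trans by metis
  moreover have "r < hi n"
  proof (cases rule: hi_cases[of n])
    case 1
    moreover have "0 < upper n"
      using less.prems emb_le_upper by (meson order_less_le_trans)
    moreover have "r \<le> upper n"
      using less.prems(1,2) le_lower lower_le_upper le_total by (meson order_trans)
    ultimately show ?thesis
      using upper_in[of n] less.prems by (metis order_less_le)
  next
    case (2 i)
    then show ?thesis using less le_trans emb_mono by (metis order_less_le_trans)
  qed
  ultimately show ?case by (simp add: emb_eq)
qed

text \<open>The element with the larger index is a midpoint: its near endpoint does not pass the
  other element's value, and its far endpoint is strictly beyond it. The far endpoint is a truth
  constant, or an earlier element, where the sum of the indices has dropped.\<close>

lemma emb_strict: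
  "\<not> j \<preceq> i \<Longrightarrow> 0 < emb j \<Longrightarrow> emb i < emb j"
proof (induction "i + j" arbitrary: i j rule: less_induct)
  case less
  have ij: "i \<preceq> j" using less.prems le_total by blast
  consider "i < j" | "j < i" using less.prems le_refl by (metis linorder_neqE_nat)
  then show ?case
  proof cases
    case 1
    have "emb i \<le> lo j" using 1 ij by (rule emb_le_lo)
    moreover have "emb i < hi j"
    proof (cases rule: hi_cases[of j])
      case 1
      have "0 < upper j" using less.prems emb_le_upper by (meson order_less_le_trans)
      then show ?thesis
        using 1 upper_in[of j] emb_less_mark[of "upper j" i] less.prems le_trans by fastforce
    next
      case (2 l)
      then show ?thesis
        using less.hyps[of i l] less.prems le_trans emb_mono
        by (metis nat_add_left_cancel_less order_less_le_trans)
    qed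
    ultimately show ?thesis by (simp add: emb_eq[of j])
  next
    case 2
    have "hi i \<le> emb j" using 2 ij by (rule hi_le_emb)
    moreover have "lo i < emb j"
    proof (cases rule: lo_cases[of i])
      case 1
      then show ?thesis
        using lower_in[of i] mark_less_emb[of "lower i" j] less.prems le_trans by fastforce
    next
      case (2 l)
      then show ?thesis
        using less.hyps[of l j] less.prems le_trans by (metis add_less_mono1)
    qed
    ultimately show ?thesis by (simp add: emb_eq[of i])
  qed
qed

section \<open>Preservation of suprema and infima\<close>

lemma finite_has_greatest:
  "finite I \<Longrightarrow> I \<noteq> {} \<Longrightarrow> \<exists>m \<in> I. \<forall>i \<in> I. i \<preceq> m"
proof (induction rule: finite_ne_induct)
  case (insert x F)
  then show ?case using le_total le_trans le_refl by (metis insert_iff)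
qed (simp add: le_refl)

lemma finite_has_least:
  "finite I \<Longrightarrow> I \<noteq> {} \<Longrightarrow> \<exists>m \<in> I. \<forall>i \<in> I. m \<preceq> i"
proof (induction rule: finite_ne_induct)
  case (insert x F)
  then show ?case using le_total le_trans le_refl by (metis insert_iff)
qed (simp add: le_refl)

text \<open>If the supremum \<open>s\<close> fell short of \<open>emb p\<close>, some
  \<open>q\<close> strictly below \<open>p\<close> would get a midpoint above \<open>s\<close>. But
  \<open>p\<close> is a least upper bound, so a member of \<open>S\<close> exceeds
  \<open>q\<close>.\<close>

lemma emb_sup:
  assumes ne: "S \<noteq> {}" and ub: "\<And>i. i \<in> S \<Longrightarrow> i \<preceq> p"
    and lub: "\<And>u. (\<And>i. i \<in> S \<Longrightarrow> i \<preceq> u) \<Longrightarrow> p \<preceq> u"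
  shows "emb p = (SUP i \<in> S. emb i)"
proof (rule ccontr)
  define s where "s = (SUP i \<in> S. emb i)"
  have bdd: "bdd_above (emb ` S)" using ub emb_mono by (intro bdd_aboveI2) blast
  have le_s: "emb i \<le> s" if "i \<in> S" for i
    unfolding s_def using that bdd by (intro cSUP_upper)
  assume "emb p \<noteq> (SUP i \<in> S. emb i)"
  moreover have "s \<le> emb p"
    unfolding s_def using ne ub emb_mono by (intro cSUP_least) auto
  ultimately have less: "s < emb p" by (simp add: s_def)
  have pos: "0 < emb p" using less le_s ne emb_nonneg by (meson ex_in_conv order_le_less_trans order_trans)
  have exceed: "\<exists>q \<in> S. \<not> q \<preceq> u" if "\<not> p \<preceq> u" for u
    using that lub by blast
  have not_le: "\<not> p \<preceq> i" if "i \<in> S" for i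
    using le_s[OF that] less emb_mono by fastforce
  \<comment> \<open>The largest truth constant whose mark is strictly below \<open>p\<close>; it
    exists because \<open>emb p\<close> is positive.\<close>
  define c where "c = Sup {r \<in> C. \<not> p \<preceq> mark r}"
  have "\<not> p \<preceq> mark 0"
    using pos emb_mono emb_mark[OF zero_in_C] by fastforce
  then have c: "c \<in> C" "\<not> p \<preceq> mark c"
    using Sup_in_C[of "{r \<in> C. \<not> p \<preceq> mark r}"] zero_in_C unfolding c_def by auto
  have c_max: "r \<le> c" if "r \<in> C" "\<not> p \<preceq> mark r" for r
    unfolding c_def using that by (intro cSup_upper bdd_C) auto
  \<comment> \<open>The midpoint of \<open>emb p\<close> and anything above
    \<open>2 * s - emb p\<close> exceeds \<open>s\<close>. The larger of \<open>a1\<close> and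
    \<open>a2\<close> meets both demands.\<close>
  obtain a where a: "a \<in> S" "\<not> a \<preceq> mark c" "2 * s - emb p < emb a"
  proof -
    obtain a1 where a1: "a1 \<in> S" "\<not> a1 \<preceq> mark c" using exceed c by blast
    obtain a2 where a2: "a2 \<in> S" "2 * s - emb p < emb a2"
      using less_cSUP_iff[OF ne bdd, of "2 * s - emb p"] less by (auto simp: s_def)
    show thesis
      using that a1 a2 le_total le_trans emb_mono by (metis order_less_le_trans)
  qed
  obtain b where b: "b \<le> a" "\<not> p \<preceq> b" "\<And>i. i \<le> a \<Longrightarrow> \<not> p \<preceq> i \<Longrightarrow> i \<preceq> b"
    using finite_has_greatest[of "{i. i \<le> a \<and> \<not> p \<preceq> i}"] a not_le by auto
  \<comment> \<open>The first element inserted strictly between \<open>b\<close> and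
    \<open>p\<close>; every earlier one lies below \<open>b\<close> or above
    \<open>p\<close>.\<close>
  define q where "q = (LEAST i. \<not> i \<preceq> b \<and> \<not> p \<preceq> i)"
  have "\<exists>i. \<not> i \<preceq> b \<and> \<not> p \<preceq> i" using exceed[OF b(2)] not_le by blast
  then have q: "\<not> q \<preceq> b" "\<not> p \<preceq> q"
    unfolding q_def using LeastI_ex[of "\<lambda>i. \<not> i \<preceq> b \<and> \<not> p \<preceq> i"] by auto
  have q_least: "p \<preceq> i" if "i < q" "\<not> i \<preceq> b" for i
    using that not_less_Least unfolding q_def by blast
  have ab: "a \<preceq> b" using a not_le b(3) by blast
  have "a < q" using q b(3) not_le_imp_less by blast
  then have "emb b \<le> lo q" using q b(1) le_total by (intro emb_le_lo) auto
  then have "2 * s - emb p < lo q" using a(3) emb_mono[OF ab] by simp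
  \<comment> \<open>No upper bound of \<open>q\<close> falls short of \<open>p\<close>: a constant
    not above \<open>p\<close> lies below \<open>mark c\<close>, hence strictly below
    \<open>q\<close>, and an earlier element above \<open>q\<close> is above
    \<open>p\<close>.\<close>
  moreover have "emb p \<le> hi q"
  proof (cases rule: hi_cases[of q])
    case 1
    have "emb p \<le> upper q"
    proof (rule le_upperI)
      fix r assume r: "r \<in> C" "q \<preceq> mark r"
      have "p \<preceq> mark r"
      proof (rule ccontr)
        assume "\<not> p \<preceq> mark r"
        then have "mark r \<preceq> mark c" using c_max r c mark_le_mark by blast
        then show False using r(2) q(1) ab a(2) le_total le_trans by meson
      qed
      then show "emb p \<le> r" using emb_mono emb_mark r(1) by metis
    qed
    then show ?thesis using 1 by simp
  next
    case (2 i)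
    then show ?thesis using q_least q(1) le_trans emb_mono by metis
  qed
  ultimately have "s < emb q" by (simp add: emb_eq[of q])
  moreover obtain i where "i \<in> S" "\<not> i \<preceq> q" using exceed q(2) by blast
  ultimately show False using le_s le_total emb_mono by (meson leD order_trans)
qed

text \<open>Order dual of \<open>emb_sup\<close>, with additional care for the constants, since the
  infimum \<open>c\<close> is known to be attained only if it is nonzero.\<close>

lemma emb_inf:
  assumes ne: "S \<noteq> {}" and lb: "\<And>i. i \<in> S \<Longrightarrow> p \<preceq> i"
    and glb: "\<And>u. (\<And>i. i \<in> S \<Longrightarrow> u \<preceq> i) \<Longrightarrow> u \<preceq> p"
  shows "emb p = (INF i \<in> S. emb i)"
proof (rule ccontr)
  define s where "s = (INF i \<in> S. emb i)"
  have bdd: "bdd_below (emb ` S)" using lb emb_mono by (intro bdd_belowI2) blast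
  have s_le: "s \<le> emb i" if "i \<in> S" for i
    unfolding s_def using that bdd by (intro cINF_lower)
  assume "emb p \<noteq> (INF i \<in> S. emb i)"
  moreover have "emb p \<le> s"
    unfolding s_def using ne lb emb_mono by (intro cINF_greatest) auto
  ultimately have less: "emb p < s" by (simp add: s_def)
  have exceed: "\<exists>q \<in> S. \<not> u \<preceq> q" if "\<not> u \<preceq> p" for u
    using that glb by blast
  have not_le: "\<not> i \<preceq> p" if "i \<in> S" for i
    using s_le[OF that] less emb_mono by fastforce
  define c where "c = Inf {r \<in> C. \<not> mark r \<preceq> p}"
  have "\<not> mark 1 \<preceq> p" using ne not_le le_mark_one le_trans by blast
  then have X: "{r \<in> C. \<not> mark r \<preceq> p} \<noteq> {}" using one_in_C by blast
  have c_min: "c \<le> r" if "r \<in> C" "\<not> mark r \<preceq> p" for r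
    unfolding c_def using that by (intro cInf_lower bdd_C) auto
  \<comment> \<open>Each mark in question exceeds some member of \<open>S\<close>, so
    \<open>s\<close> bounds these constants from below; hence \<open>c\<close> is positive and
    attained.\<close>
  have "s \<le> c"
    unfolding c_def
  proof (rule cInf_greatest[OF X])
    fix r assume r: "r \<in> {r \<in> C. \<not> mark r \<preceq> p}"
    then obtain q where "q \<in> S" "\<not> mark r \<preceq> q" using exceed by blast
    then show "s \<le> r"
      using r s_le emb_mono emb_mark le_total by (metis (mono_tags, lifting) mem_Collect_eq order_trans)
  qed
  then have "c \<noteq> 0" using less emb_nonneg[of p] by auto
  then have c: "c \<in> C" "\<not> mark c \<preceq> p"
    using Inf_in_C[OF _ X] unfolding c_def by auto
  obtain a where a: "a \<in> S" "\<not> mark c \<preceq> a" "emb a < 2 * s - emb p"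
  proof -
    obtain a1 where a1: "a1 \<in> S" "\<not> mark c \<preceq> a1" using exceed c by blast
    obtain a2 where a2: "a2 \<in> S" "emb a2 < 2 * s - emb p"
      using cINF_less_iff[OF ne bdd, of "2 * s - emb p"] less by (auto simp: s_def)
    show thesis
      using that a1 a2 le_total le_trans emb_mono by (metis order_le_less_trans)
  qed
  obtain b where b: "b \<le> a" "\<not> b \<preceq> p" "\<And>i. i \<le> a \<Longrightarrow> \<not> i \<preceq> p \<Longrightarrow> b \<preceq> i"
    using finite_has_least[of "{i. i \<le> a \<and> \<not> i \<preceq> p}"] a not_le by auto
  define q where "q = (LEAST i. \<not> b \<preceq> i \<and> \<not> i \<preceq> p)"
  have "\<exists>i. \<not> b \<preceq> i \<and> \<not> i \<preceq> p" using exceed[OF b(2)] not_le by blast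
  then have q: "\<not> b \<preceq> q" "\<not> q \<preceq> p"
    unfolding q_def using LeastI_ex[of "\<lambda>i. \<not> b \<preceq> i \<and> \<not> i \<preceq> p"] by auto
  have q_least: "i \<preceq> p" if "i < q" "\<not> b \<preceq> i" for i
    using that not_less_Least unfolding q_def by blast
  have ba: "b \<preceq> a" using a not_le b(3) by blast
  have "a < q" using q b(3) not_le_imp_less by blast
  then have "hi q \<le> emb b" using q b(1) le_total by (intro hi_le_emb) auto
  then have "hi q < 2 * s - emb p" using a(3) emb_mono[OF ba] by simp
  moreover have "lo q \<le> emb p"
  proof (cases rule: lo_cases[of q])
    case 1
    \<comment> \<open>Conditional because \<open>lower q\<close> may be the default 0, which is
      below \<open>emb p\<close> anyway.\<close>
    have "mark (lower q) \<preceq> p" if m: "mark (lower q) \<preceq> q"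
    proof (rule ccontr)
      assume "\<not> mark (lower q) \<preceq> p"
      then have "mark c \<preceq> mark (lower q)" using c_min lower_in c mark_le_mark by blast
      then show False using m q(1) ba a(2) le_total le_trans by meson
    qed
    then show ?thesis
      using 1 lower_in[of q] emb_mono emb_mark emb_nonneg by metis
  next
    case (2 i)
    then show ?thesis using q_least q(1) le_trans emb_mono by metis
  qed
  ultimately have "emb q < s" by (simp add: emb_eq[of q])
  moreover obtain i where "i \<in> S" "\<not> q \<preceq> i" using exceed q(2) by blast
  ultimately show False using s_le le_total emb_mono by (meson leD order_trans)
qed

end


section \<open>Countability and closed substitutions\<close>

text \<open>Stratified by size, since only the symbols of \<open>L\<close> are countable, not
  necessarily their type.\<close>

lemma countable_wf_tm:
  assumes "countable (funs L)"
  shows "countable {t. wf_tm L t}"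
proof -
  have "countable {t. wf_tm L t \<and> size t < n}" for n
  proof (induction n)
    case (Suc n)
    let ?T = "{t. wf_tm L t \<and> size t < n}"
    have "{t. wf_tm L t \<and> size t < Suc n} \<subseteq>
        range Var \<union> (\<lambda>(f, ts). Fun f ts) ` (funs L \<times> lists ?T)"
    proof
      fix t assume t: "t \<in> {t. wf_tm L t \<and> size t < Suc n}"
      show "t \<in> range Var \<union> (\<lambda>(f, ts). Fun f ts) ` (funs L \<times> lists ?T)"
      proof (cases t)
        case (Fun f ts)
        have "size s < size t" if "s \<in> set ts" for s
          using that size_list_estimation'[of s ts "size s" size] Fun by simp
        then have "s \<in> ?T" if "s \<in> set ts" for s
          using that t Fun by fastforce
        then have "ts \<in> lists ?T" by blast
        then show ?thesis using t Fun by (auto simp: image_iff)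
      qed simp
    qed
    then show ?case
      by (rule countable_subset) (use assms Suc in \<open>auto intro: countable_lists\<close>)
  qed simp
  then have "countable (\<Union>n. {t. wf_tm L t \<and> size t < n})" by blast
  moreover have "{t. wf_tm L t} \<subseteq> (\<Union>n. {t. wf_tm L t \<and> size t < n})" by auto
  ultimately show ?thesis by (rule countable_subset[rotated])
qed

text \<open>Unlike \<open>size\<close>, this measure is invariant under substitution of terms.\<close>

fun depth :: "('f, 'p) fm \<Rightarrow> nat" where
  "depth (Tr r) = 0"
| "depth (Pred P ts) = 0"
| "depth (Conj \<phi> \<psi>) = Suc (max (depth \<phi>) (depth \<psi>))"
| "depth (Imp \<phi> \<psi>) = Suc (max (depth \<phi>) (depth \<psi>))"
| "depth (All x \<phi>) = Suc (depth \<phi>)"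
| "depth (Ex x \<phi>) = Suc (depth \<phi>)"

lemma depth_subst [simp]: "depth (subst x t \<phi>) = depth \<phi>"
  by (induction \<phi>) auto

lemma countable_wf_fm:
  assumes "countable_language L" "countable A"
  shows "countable {\<phi>. wf_fm L A \<phi>}"
proof -
  have funs: "countable (funs L)" and preds: "countable (preds L)"
    using assms(1) by (auto simp: countable_language_def)
  have "countable {\<phi>. wf_fm L A \<phi> \<and> depth \<phi> < n}" for n
  proof (induction n)
    case (Suc n)
    let ?F = "{\<phi>. wf_fm L A \<phi> \<and> depth \<phi> < n}"
    let ?U = "Tr ` (A \<union> {0, 1}) \<union> (\<lambda>(P, ts). Pred P ts) ` (preds L \<times> lists {t. wf_tm L t}) \<union>
        (\<lambda>(\<phi>, \<psi>). Conj \<phi> \<psi>) ` (?F \<times> ?F) \<union> (\<lambda>(\<phi>, \<psi>). Imp \<phi> \<psi>) ` (?F \<times> ?F) \<union>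
        (\<lambda>(x, \<phi>). All x \<phi>) ` (UNIV \<times> ?F) \<union> (\<lambda>(x, \<phi>). Ex x \<phi>) ` (UNIV \<times> ?F)"
    have "\<phi> \<in> ?U" if "wf_fm L A \<phi>" "depth \<phi> < Suc n" for \<phi>
      using that by (cases \<phi>) (auto simp: image_iff)
    then have "{\<phi>. wf_fm L A \<phi> \<and> depth \<phi> < Suc n} \<subseteq> ?U" by blast
    moreover have "countable ?U"
      using assms(2) preds countable_wf_tm[OF funs] Suc by (auto intro!: countable_lists)
    ultimately show ?case by (rule countable_subset)
  qed simp
  then have "countable (\<Union>n. {\<phi>. wf_fm L A \<phi> \<and> depth \<phi> < n})" by blast
  moreover have "{\<phi>. wf_fm L A \<phi>} \<subseteq> (\<Union>n. {\<phi>. wf_fm L A \<phi> \<and> depth \<phi> < n})" by auto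
  ultimately show ?thesis by (rule countable_subset[rotated])
qed

section \<open>Substitution of closed terms\<close>

lemma wf_subst_tm: "wf_tm L s \<Longrightarrow> wf_tm L t \<Longrightarrow> wf_tm L (subst_tm x t s)"
  by (induction s) auto

lemma wf_subst: "wf_fm L A \<phi> \<Longrightarrow> wf_tm L t \<Longrightarrow> wf_fm L A (subst x t \<phi>)"
  by (induction \<phi>) (auto simp: wf_subst_tm)

lemma vars_subst_tm: "vars_tm t = {} \<Longrightarrow> vars_tm (subst_tm x t s) = vars_tm s - {x}"
  by (induction s) auto

lemma free_vars_subst: "vars_tm t = {} \<Longrightarrow> free_vars (subst x t \<phi>) = free_vars \<phi> - {x}"
  by (induction \<phi>) (auto simp: vars_subst_tm)

lemma substitutable_closed: "vars_tm t = {} \<Longrightarrow> substitutable x t \<phi>"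
  by (induction \<phi>) auto

lemma subst_tm_fresh: "x \<notin> vars_tm s \<Longrightarrow> subst_tm x t s = s"
  by (induction s) (auto intro: map_idI)

lemma subst_fresh: "x \<notin> free_vars \<phi> \<Longrightarrow> subst x t \<phi> = \<phi>"
  by (induction \<phi>) (auto intro!: map_idI subst_tm_fresh)

lemma eval_subst_tm: "eval_tm M e (subst_tm x t s) = eval_tm M (e(x := eval_tm M e t)) s"
  by (induction s) (auto simp: comp_def cong: map_cong)

text \<open>A closed term has the same value under every assignment and cannot be captured, so no
  substitutability condition arises.\<close>

lemma eval_subst:
  assumes "vars_tm t = {}"
  shows "eval M e (subst x t \<phi>) = eval M (e(x := eval_tm M e t)) \<phi>"
proof (induction \<phi> arbitrary: e)
  case (Pred P ts)
  then show ?case by (simp add: eval_subst_tm comp_def del: fun_upd_apply)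
next
  case (All y \<phi>)
  have "eval_tm M (e(y := a)) t = eval_tm M e t" for a
    using assms by (intro eval_tm_cong) auto
  then show ?case using All by (simp add: fun_upd_twist del: fun_upd_apply)
next
  case (Ex y \<phi>)
  have "eval_tm M (e(y := a)) t = eval_tm M e t" for a
    using assms by (intro eval_tm_cong) auto
  then show ?case using Ex by (simp add: fun_upd_twist del: fun_upd_apply)
qed auto


section \<open>Derivations\<close>

context
  fixes L :: "('f, 'p) language" and A :: "real set" and T :: "('f, 'p) fm set"
begin

abbreviation provable :: "('f, 'p) fm \<Rightarrow> bool" ("\<turnstile> _" [50] 50) where
  "\<turnstile> \<phi> \<equiv> derives L A T \<phi>"

lemma derives_wf: "\<turnstile> \<phi> \<Longrightarrow> wf_fm L A \<phi>"
  by (induction rule: derives.induct) auto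

lemma imp_wf: "\<turnstile> Imp \<phi> \<psi> \<Longrightarrow> wf_fm L A \<phi>" "\<turnstile> Imp \<phi> \<psi> \<Longrightarrow> wf_fm L A \<psi>"
  using derives_wf by fastforce+

lemma imp_trans:
  assumes "\<turnstile> Imp \<phi> \<psi>" "\<turnstile> Imp \<psi> \<theta>"
  shows "\<turnstile> Imp \<phi> \<theta>"
proof -
  have "\<turnstile> Imp (Imp \<phi> \<psi>) (Imp (Imp \<psi> \<theta>) (Imp \<phi> \<theta>))"
    using assms imp_wf by (intro Ax G1) auto
  then show ?thesis using assms MP by blast
qed

lemma conj_imp_left: "wf_fm L A \<phi> \<Longrightarrow> wf_fm L A \<psi> \<Longrightarrow> \<turnstile> Imp (Conj \<phi> \<psi>) \<phi>"
  by (intro Ax G2) auto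

lemma conj_imp_commute: "wf_fm L A \<phi> \<Longrightarrow> wf_fm L A \<psi> \<Longrightarrow> \<turnstile> Imp (Conj \<phi> \<psi>) (Conj \<psi> \<phi>)"
  by (intro Ax G3) auto

lemma conj_imp_right: "wf_fm L A \<phi> \<Longrightarrow> wf_fm L A \<psi> \<Longrightarrow> \<turnstile> Imp (Conj \<phi> \<psi>) \<psi>"
  using conj_imp_commute conj_imp_left imp_trans by blast

lemma conjD:
  assumes "\<turnstile> Conj \<phi> \<psi>"
  shows "\<turnstile> \<phi>" "\<turnstile> \<psi>"
  using derives_wf[OF assms] MP[OF assms conj_imp_left] MP[OF assms conj_imp_right] by auto

lemma imp_curry:
  assumes "\<turnstile> Imp (Conj \<phi> \<psi>) \<theta>"
  shows "\<turnstile> Imp \<phi> (Imp \<psi> \<theta>)"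
proof -
  have "\<turnstile> Iff (Imp \<phi> (Imp \<psi> \<theta>)) (Imp (Conj \<phi> \<psi>) \<theta>)"
    using imp_wf[OF assms] by (intro Ax G5) auto
  then show ?thesis using assms conjD MP by blast
qed

lemma imp_uncurry:
  assumes "\<turnstile> Imp \<phi> (Imp \<psi> \<theta>)"
  shows "\<turnstile> Imp (Conj \<phi> \<psi>) \<theta>"
proof -
  have "\<turnstile> Iff (Imp \<phi> (Imp \<psi> \<theta>)) (Imp (Conj \<phi> \<psi>) \<theta>)"
    using imp_wf[OF assms] by (intro Ax G5) auto
  then show ?thesis using assms conjD MP by blast
qed

lemma imp_weaken: "wf_fm L A \<phi> \<Longrightarrow> wf_fm L A \<psi> \<Longrightarrow> \<turnstile> Imp \<phi> (Imp \<psi> \<phi>)"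
  by (intro imp_curry conj_imp_left)

lemma derives_weaken: "\<turnstile> \<phi> \<Longrightarrow> wf_fm L A \<psi> \<Longrightarrow> \<turnstile> Imp \<psi> \<phi>"
  using imp_weaken derives_wf MP by blast

lemma imp_contract:
  assumes "\<turnstile> Imp \<phi> (Imp \<phi> \<psi>)"
  shows "\<turnstile> Imp \<phi> \<psi>"
proof -
  have "\<turnstile> Imp \<phi> (Conj \<phi> \<phi>)" using imp_wf[OF assms] by (intro Ax G4) auto
  then show ?thesis using imp_uncurry[OF assms] by (rule imp_trans)
qed

text \<open>Currying \<open>G3\<close> gives
  \<open>Imp \<psi> (Imp \<phi> (Conj \<phi> \<psi>))\<close>; compose with the assumption and
  contract the doubled \<open>\<phi>\<close>.\<close>

lemma imp_conj:
  assumes "\<turnstile> Imp \<phi> \<psi>"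
  shows "\<turnstile> Imp \<phi> (Conj \<phi> \<psi>)"
  using imp_contract[OF imp_trans[OF assms imp_curry[OF conj_imp_commute]]] imp_wf[OF assms]
  by blast

end


section \<open>The value of a sentence\<close>

locale henkin_theory =
  fixes L :: "('f, 'p) language" and A :: "real set" and T :: "('f, 'p) fm set"
  assumes countable_L: "countable_language L"
    and A_sub: "A \<subseteq> {0<..<1}" and countable_A: "countable A"
    and A_islimpt: "{x \<in> {0..1}. x islimpt A} \<subseteq> {0}"
    and consistent: "strongly_consistent L A T"
    and complete: "deductively_complete L A T"
    and henkin: "deductively_henkin L A T"
begin

abbreviation provable_L :: "('f, 'p) fm \<Rightarrow> bool" ("\<turnstile> _" [50] 50) where
  "\<turnstile> \<phi> \<equiv> derives L A T \<phi>"

abbreviation sentences :: "('f, 'p) fm set" where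
  "sentences \<equiv> {\<phi>. is_sentence L A \<phi>}"

abbreviation nth_sentence :: "nat \<Rightarrow> ('f, 'p) fm" where
  "nth_sentence \<equiv> from_nat_into sentences"

abbreviation index :: "('f, 'p) fm \<Rightarrow> nat" where
  "index \<equiv> to_nat_on sentences"

definition closed_terms :: "'f tm set" where
  "closed_terms = {t. wf_tm L t \<and> vars_tm t = {}}"

lemma countable_sentences: "countable sentences"
  by (rule countable_subset[OF _ countable_wf_fm[OF countable_L countable_A]])
    (auto simp: is_sentence_def)

lemma countable_closed_terms: "countable closed_terms"
  by (rule countable_subset[OF _ countable_wf_tm])
    (use countable_L in \<open>auto simp: closed_terms_def countable_language_def\<close>)

lemma nth_sentence_index: "is_sentence L A \<phi> \<Longrightarrow> nth_sentence (index \<phi>) = \<phi>"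
  using countable_sentences by (intro from_nat_into_to_nat_on) auto

lemma sentence_Tr: "r \<in> A \<union> {0, 1} \<Longrightarrow> is_sentence L A (Tr r)"
  by (simp add: is_sentence_def)

lemma nth_sentence: "is_sentence L A (nth_sentence n)"
  using from_nat_into[of sentences n] sentence_Tr[of 1] by blast

lemma sentence_wf: "is_sentence L A \<phi> \<Longrightarrow> wf_fm L A \<phi>"
  by (simp add: is_sentence_def)

lemma sentence_subst:
  assumes "is_sentence L A (All x \<phi>) \<or> is_sentence L A (Ex x \<phi>)" "t \<in> closed_terms"
  shows "is_sentence L A (subst x t \<phi>)"
  using assms by (auto simp: is_sentence_def closed_terms_def wf_subst free_vars_subst)

lemma constant_closed: "c \<in> constants L \<Longrightarrow> Fun c [] \<in> closed_terms"
  by (simp add: constants_def closed_terms_def)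

lemma total: "is_sentence L A \<phi> \<Longrightarrow> is_sentence L A \<psi> \<Longrightarrow> \<turnstile> Imp \<phi> \<psi> \<or> \<turnstile> Imp \<psi> \<phi>"
  using complete by (auto simp: deductively_complete_def)

text \<open>For \<open>r < s\<close>, \<open>RG2b\<close> would turn a proof of the implication into
  one of \<open>Tr s\<close>, where \<open>s\<close> is positive, against strong
  consistency.\<close>

lemma imp_Tr_iff:
  assumes "r \<in> A \<union> {0, 1}" "s \<in> A \<union> {0, 1}"
  shows "\<turnstile> Imp (Tr r) (Tr s) \<longleftrightarrow> s \<le> r"
proof
  assume imp: "\<turnstile> Imp (Tr r) (Tr s)"
  show "s \<le> r"
  proof (rule ccontr)
    assume "\<not> s \<le> r"
    then have "\<turnstile> Iff (Imp (Tr r) (Tr s)) (Tr s)"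
      using assms by (intro Ax RG2b) auto
    then have "\<turnstile> Tr s" using imp conjD MP by blast
    moreover have "s \<in> A \<union> {1}" using assms A_sub \<open>\<not> s \<le> r\<close> by auto
    ultimately show False using consistent by (auto simp: strongly_consistent_def)
  qed
next
  assume "s \<le> r"
  then show "\<turnstile> Imp (Tr r) (Tr s)" using assms by (intro Ax RG2a) auto
qed

text \<open>The order is reversed implication because truth has value 0: a sentence lies above
  whatever it implies. Adding 0 and 1 to \<open>A\<close> creates no limit points.\<close>

sublocale marked_preorder
  "\<lambda>i j. \<turnstile> Imp (nth_sentence j) (nth_sentence i)" "A \<union> {0, 1}" "\<lambda>r. index (Tr r)"
proof
  show "\<turnstile> Imp (nth_sentence j) (nth_sentence i) \<or> \<turnstile> Imp (nth_sentence i) (nth_sentence j)" for i j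
    using total nth_sentence by blast
  show "A \<union> {0, 1} \<subseteq> {0..1}" using A_sub by auto
  show "x = 0" if "x \<in> {0..1}" "x islimpt A \<union> {0, 1}" for x :: real
    using that A_islimpt by (auto simp: islimpt_insert)
  show "\<turnstile> Imp (nth_sentence (index (Tr s))) (nth_sentence (index (Tr r))) \<longleftrightarrow> r \<le> s"
    if "r \<in> A \<union> {0, 1}" "s \<in> A \<union> {0, 1}" for r s
    unfolding nth_sentence_index[OF sentence_Tr[OF that(1)]]
      nth_sentence_index[OF sentence_Tr[OF that(2)]] by (rule imp_Tr_iff[OF that(2,1)])
  show "\<turnstile> Imp (nth_sentence (index (Tr 1))) (nth_sentence n)" for n
  proof -
    have "\<turnstile> Imp (Tr 1) (nth_sentence n)"
      using sentence_wf[OF nth_sentence] by (intro Ax G7) auto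
    then show ?thesis by (simp add: nth_sentence_index sentence_Tr)
  qed
qed (auto intro: imp_trans)

section \<open>Values of truth constants and connectives\<close>

definition val :: "('f, 'p) fm \<Rightarrow> real" where
  "val \<phi> = emb (index \<phi>)"

lemma val_unit: "val \<phi> \<in> {0..1}"
  using emb_nonneg order_trans[OF emb_le_upper upper_le[OF one_in_C le_mark_one]]
  by (simp add: val_def)

lemma val_antimono:
  "is_sentence L A \<phi> \<Longrightarrow> is_sentence L A \<psi> \<Longrightarrow> \<turnstile> Imp \<phi> \<psi> \<Longrightarrow> val \<psi> \<le> val \<phi>"
  unfolding val_def by (rule emb_mono) (simp add: nth_sentence_index)

lemma val_eqI:
  "is_sentence L A \<phi> \<Longrightarrow> is_sentence L A \<psi> \<Longrightarrow> \<turnstile> Imp \<phi> \<psi> \<Longrightarrow> \<turnstile> Imp \<psi> \<phi> \<Longrightarrow> val \<phi> = val \<psi>"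
  using val_antimono by (meson order_antisym)

lemma val_Tr: "r \<in> A \<union> {0, 1} \<Longrightarrow> val (Tr r) = r"
  unfolding val_def by (rule emb_mark)

lemma val_provable:
  assumes "is_sentence L A \<phi>" "\<turnstile> \<phi>"
  shows "val \<phi> = 0"
proof -
  have "\<turnstile> Imp (Tr 0) \<phi>" using assms(2) by (rule derives_weaken) simp
  then have "val \<phi> \<le> val (Tr 0)" using assms(1) by (intro val_antimono sentence_Tr) auto
  then show ?thesis using val_unit[of \<phi>] by (simp add: val_Tr)
qed

text \<open>By completeness one conjunct implies the other and is then equivalent to the
  conjunction.\<close>

lemma val_Conj:
  assumes "is_sentence L A \<phi>" "is_sentence L A \<psi>"
  shows "val (Conj \<phi> \<psi>) = max (val \<phi>) (val \<psi>)"
proof -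
  have s: "is_sentence L A (Conj \<phi> \<psi>)" using assms by (simp add: is_sentence_def)
  note wf = assms[THEN sentence_wf]
  have le: "val \<phi> \<le> val (Conj \<phi> \<psi>)" "val \<psi> \<le> val (Conj \<phi> \<psi>)"
    using assms s conj_imp_left[OF wf] conj_imp_right[OF wf] by (auto intro: val_antimono)
  from total[OF assms] have "val (Conj \<phi> \<psi>) \<le> max (val \<phi>) (val \<psi>)"
  proof
    assume "\<turnstile> Imp \<phi> \<psi>"
    then have "val (Conj \<phi> \<psi>) \<le> val \<phi>" by (intro val_antimono assms s imp_conj)
    then show ?thesis by simp
  next
    assume "\<turnstile> Imp \<psi> \<phi>"
    then have "\<turnstile> Imp \<psi> (Conj \<phi> \<psi>)"
      by (rule imp_trans[OF imp_conj conj_imp_commute[OF wf(2,1)]])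
    then have "val (Conj \<phi> \<psi>) \<le> val \<psi>" by (intro val_antimono assms s)
    then show ?thesis by simp
  qed
  then show ?thesis using le by simp
qed

text \<open>Completeness is applied to \<open>\<phi>\<close> and \<open>Imp \<phi> \<psi>\<close>.
  If the implication is unprovable, contraction rules out one direction, and the other makes it
  equivalent to \<open>\<psi>\<close>.\<close>

lemma val_Imp:
  assumes "is_sentence L A \<phi>" "is_sentence L A \<psi>"
  shows "val (Imp \<phi> \<psi>) = gimp (val \<phi>) (val \<psi>)"
proof -
  have s: "is_sentence L A (Imp \<phi> \<psi>)" using assms by (simp add: is_sentence_def)
  show ?thesis
  proof (cases "\<turnstile> Imp \<phi> \<psi>")
    case True
    then show ?thesis
      using val_antimono[OF assms] val_provable[OF s] by (simp add: gimp_def)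
  next
    case False
    have "\<turnstile> Imp (Imp \<phi> \<psi>) \<phi>" using total[OF assms(1) s] False imp_contract by blast
    moreover have "\<turnstile> Imp (Imp \<phi> \<psi>) (Imp \<phi> \<psi>)" using total[OF s s] by blast
    \<comment> \<open>Modus ponens inside the logic, from \<open>Imp \<phi> \<psi>\<close> and the
      \<open>\<phi>\<close> that it implies.\<close>
    ultimately have "\<turnstile> Imp (Imp \<phi> \<psi>) \<psi>" by (rule imp_trans[OF imp_conj imp_uncurry])
    then have eq: "val (Imp \<phi> \<psi>) = val \<psi>"
      by (rule val_eqI[OF s assms(2)]) (intro imp_weaken sentence_wf assms)
    \<comment> \<open>If \<open>val \<psi>\<close> is 0, strictness may fail, but then
      \<open>gimp\<close> is 0 as well.\<close>
    have "val \<phi> < val \<psi>" if "0 < val \<psi>"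
      using that False assms unfolding val_def by (intro emb_strict) (auto simp: nth_sentence_index)
    then show ?thesis
      using eq val_unit[of \<psi>] val_unit[of \<phi>] by (cases "0 < val \<psi>") (auto simp: gimp_def)
  qed
qed

section \<open>Values of quantified sentences\<close>

lemma henkin_provable:
  assumes "is_sentence L A (All x \<phi>)" "\<And>t. t \<in> closed_terms \<Longrightarrow> \<turnstile> subst x t \<phi>"
  shows "\<turnstile> All x \<phi>"
  using henkin assms constant_closed unfolding deductively_henkin_def by blast

text \<open>Without closed terms the Henkin property would vacuously prove a universally quantified
  falsity.\<close>

lemma closed_terms_nonempty: "closed_terms \<noteq> {}"
proof
  assume "closed_terms = {}"
  then have "\<turnstile> All 0 (Tr 1)"
    by (intro henkin_provable) (auto simp: is_sentence_def)
  moreover have "\<turnstile> Imp (All 0 (Tr 1)) (subst 0 (Var 0) (Tr 1))"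
    by (intro Ax GAll1) auto
  ultimately have "\<turnstile> Tr 1" using MP by fastforce
  then show False using consistent by (auto simp: strongly_consistent_def)
qed

text \<open>\<open>GAll1\<close> makes the sentence an upper bound of its closed instances;
  \<open>GAll2\<close> and the Henkin property make it the least one, so \<open>emb_sup\<close>
  applies.\<close>

lemma val_All:
  assumes s: "is_sentence L A (All x \<phi>)"
  shows "val (All x \<phi>) = (SUP t \<in> closed_terms. val (subst x t \<phi>))"
proof -
  have sub: "nth_sentence (index (subst x t \<phi>)) = subst x t \<phi>" if "t \<in> closed_terms" for t
    using sentence_subst[OF disjI1[OF s] that] by (rule nth_sentence_index)
  have inst: "\<turnstile> Imp (All x \<phi>) (subst x t \<phi>)" if "t \<in> closed_terms" for t
    using that s by (intro Ax GAll1)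
      (auto simp: closed_terms_def is_sentence_def substitutable_closed wf_subst)
  have lub: "\<turnstile> Imp \<psi> (All x \<phi>)"
    if \<psi>: "is_sentence L A \<psi>" and ub: "\<And>t. t \<in> closed_terms \<Longrightarrow> \<turnstile> Imp \<psi> (subst x t \<phi>)" for \<psi>
  proof -
    \<comment> \<open>As \<open>\<psi>\<close> is closed, the instances are exactly the implications
      in \<open>ub\<close>.\<close>
    have "\<turnstile> All x (Imp \<psi> \<phi>)"
      using \<psi> s ub by (intro henkin_provable) (auto simp: is_sentence_def subst_fresh)
    moreover have "\<turnstile> Imp (All x (Imp \<psi> \<phi>)) (Imp \<psi> (All x \<phi>))"
      using \<psi> s by (intro Ax GAll2) (auto simp: is_sentence_def)
    ultimately show ?thesis by (rule MP)
  qed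
  have "emb (index (All x \<phi>)) = (SUP i \<in> (\<lambda>t. index (subst x t \<phi>)) ` closed_terms. emb i)"
  proof (rule emb_sup)
    fix u
    assume u: "\<And>i. i \<in> (\<lambda>t. index (subst x t \<phi>)) ` closed_terms \<Longrightarrow> \<turnstile> Imp (nth_sentence u) (nth_sentence i)"
    have "\<turnstile> Imp (nth_sentence u) (subst x t \<phi>)" if "t \<in> closed_terms" for t
      using u[OF imageI[OF that]] sub[OF that] by simp
    then show "\<turnstile> Imp (nth_sentence u) (nth_sentence (index (All x \<phi>)))"
      using lub[OF nth_sentence] nth_sentence_index[OF s] by simp
  qed (use closed_terms_nonempty inst sub nth_sentence_index[OF s] in auto)
  then show ?thesis by (simp add: val_def image_image)
qed

text \<open>Dual, by \<open>GEx1\<close> and \<open>GEx2\<close>. The Henkin property for universal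
  sentences suffices, being applied to \<open>All x (Imp \<phi> \<psi>)\<close>.\<close>

lemma val_Ex:
  assumes s: "is_sentence L A (Ex x \<phi>)"
  shows "val (Ex x \<phi>) = (INF t \<in> closed_terms. val (subst x t \<phi>))"
proof -
  have sub: "nth_sentence (index (subst x t \<phi>)) = subst x t \<phi>" if "t \<in> closed_terms" for t
    using sentence_subst[OF disjI2[OF s] that] by (rule nth_sentence_index)
  have inst: "\<turnstile> Imp (subst x t \<phi>) (Ex x \<phi>)" if "t \<in> closed_terms" for t
    using that s by (intro Ax GEx1)
      (auto simp: closed_terms_def is_sentence_def substitutable_closed wf_subst)
  have glb: "\<turnstile> Imp (Ex x \<phi>) \<psi>"
    if \<psi>: "is_sentence L A \<psi>" and lb: "\<And>t. t \<in> closed_terms \<Longrightarrow> \<turnstile> Imp (subst x t \<phi>) \<psi>" for \<psi>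
  proof -
    have "\<turnstile> All x (Imp \<phi> \<psi>)"
      using \<psi> s lb by (intro henkin_provable) (auto simp: is_sentence_def subst_fresh)
    moreover have "\<turnstile> Imp (All x (Imp \<phi> \<psi>)) (Imp (Ex x \<phi>) \<psi>)"
      using \<psi> s by (intro Ax GEx2) (auto simp: is_sentence_def)
    ultimately show ?thesis by (rule MP)
  qed
  have "emb (index (Ex x \<phi>)) = (INF i \<in> (\<lambda>t. index (subst x t \<phi>)) ` closed_terms. emb i)"
  proof (rule emb_inf)
    fix u
    assume u: "\<And>i. i \<in> (\<lambda>t. index (subst x t \<phi>)) ` closed_terms \<Longrightarrow> \<turnstile> Imp (nth_sentence i) (nth_sentence u)"
    have "\<turnstile> Imp (subst x t \<phi>) (nth_sentence u)" if "t \<in> closed_terms" for t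
      using u[OF imageI[OF that]] sub[OF that] by simp
    then show "\<turnstile> Imp (nth_sentence (index (Ex x \<phi>))) (nth_sentence u)"
      using glb[OF nth_sentence] nth_sentence_index[OF s] by simp
  qed (use closed_terms_nonempty inst sub nth_sentence_index[OF s] in auto)
  then show ?thesis by (simp add: val_def image_image)
qed


section \<open>The term model\<close>

text \<open>The Herbrand structure of closed terms, transported along \<open>code\<close> because
  the type of the universe is prescribed.\<close>

definition term_model :: "('f tm \<Rightarrow> 'u) \<Rightarrow> ('u, 'f, 'p) struct" where
  "term_model code =
     \<lparr>univ = code ` closed_terms,
      fun_int = \<lambda>f us. code (Fun f (map (inv_into closed_terms code) us)),
      pred_int = \<lambda>P us. val (Pred P (map (inv_into closed_terms code) us))\<rparr>"

lemma is_structure_term_model: "is_structure L (term_model code)"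
proof -
  have "Fun f (map (inv_into closed_terms code) us) \<in> closed_terms"
    if "f \<in> funs L" "length us = fun_arity L f" "set us \<subseteq> code ` closed_terms" for f us
  proof -
    have "inv_into closed_terms code u \<in> closed_terms" if "u \<in> set us" for u
      using that \<open>set us \<subseteq> code ` closed_terms\<close> by (intro inv_into_into) blast
    then show ?thesis using that(1,2) by (auto simp: closed_terms_def)
  qed
  then show ?thesis
    using closed_terms_nonempty val_unit by (auto simp: is_structure_def term_model_def)
qed

context
  fixes code :: "'f tm \<Rightarrow> 'u"
  assumes inj: "inj_on code closed_terms"
begin

lemma decode_list:
  "set ts \<subseteq> closed_terms \<Longrightarrow> map (inv_into closed_terms code) (map code ts) = ts"
  using inj by (auto intro!: map_idI)

lemma eval_tm_term_model: "t \<in> closed_terms \<Longrightarrow> eval_tm (term_model code) e t = code t"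
proof (induction t)
  case (Var x)
  then show ?case by (simp add: closed_terms_def)
next
  case (Fun f ts)
  have ts: "set ts \<subseteq> closed_terms" using Fun.prems by (auto simp: closed_terms_def)
  then have "map (eval_tm (term_model code) e) ts = map code ts" using Fun.IH by auto
  then have "eval_tm (term_model code) e (Fun f ts) = fun_int (term_model code) f (map code ts)"
    by (metis eval_tm.simps(2))
  also have "\<dots> = code (Fun f ts)"
    unfolding term_model_def by (simp only: struct.simps decode_list[OF ts])
  finally show ?case .
qed

lemma eval_term_model_upd:
  assumes "t \<in> closed_terms"
  shows "eval (term_model code) (e(x := code t)) \<phi> = eval (term_model code) e (subst x t \<phi>)"
  using assms eval_tm_term_model[OF assms, of e]
  by (subst eval_subst) (auto simp: closed_terms_def)

text \<open>Induction on \<open>depth\<close>, since closed instances are not subformulas. Updates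
  of the assignment become substitutions, so \<open>e\<close> stays fixed.\<close>

lemma eval_term_model:
  "is_sentence L A \<phi> \<Longrightarrow> eval (term_model code) e \<phi> = val \<phi>"
proof (induction \<phi> rule: measure_induct_rule[of depth])
  case (less \<phi>)
  let ?M = "term_model code"
  have univ: "univ ?M = code ` closed_terms" by (simp add: term_model_def)
  show ?case
  proof (cases \<phi>)
    case (Tr r)
    then show ?thesis using less.prems val_Tr by (simp add: is_sentence_def)
  next
    case (Pred P ts)
    have ts: "set ts \<subseteq> closed_terms"
      using less.prems Pred by (auto simp: is_sentence_def closed_terms_def)
    then have "map (eval_tm ?M e) ts = map code ts" using eval_tm_term_model by auto
    then have "eval ?M e \<phi> = pred_int ?M P (map code ts)" using Pred by (metis eval.simps(2))
    also have "\<dots> = val \<phi>"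
      unfolding term_model_def Pred by (simp only: struct.simps decode_list[OF ts])
    finally show ?thesis .
  next
    case (Conj \<phi>1 \<phi>2)
    then have "is_sentence L A \<phi>1" "is_sentence L A \<phi>2"
      using less.prems by (auto simp: is_sentence_def)
    then show ?thesis using Conj less.IH by (simp add: val_Conj)
  next
    case (Imp \<phi>1 \<phi>2)
    then have "is_sentence L A \<phi>1" "is_sentence L A \<phi>2"
      using less.prems by (auto simp: is_sentence_def)
    then show ?thesis using Imp less.IH by (simp add: val_Imp)
  next
    case (All x \<phi>')
    have "eval ?M (e(x := code t)) \<phi>' = val (subst x t \<phi>')" if "t \<in> closed_terms" for t
      using that less All sentence_subst[OF _ that] by (simp add: eval_term_model_upd)
    then show ?thesis using All less.prems by (simp add: val_All univ image_image)
  next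
    case (Ex x \<phi>')
    have "eval ?M (e(x := code t)) \<phi>' = val (subst x t \<phi>')" if "t \<in> closed_terms" for t
      using that less Ex sentence_subst[OF _ that] by (simp add: eval_term_model_upd)
    then show ?thesis using Ex less.prems by (simp add: val_Ex univ image_image)
  qed
qed

end

end

theorem theorem3p8:
  fixes L :: "('f, 'p) language" and A :: "real set" and T :: "('f, 'p) fm set"
  assumes "countable_language L"
    and "A \<subseteq> {0<..<1}" and "countable A"
    and "{x \<in> {0..1}. x islimpt A} \<subseteq> {0}"
    and "is_theory L A T"
    and "strongly_consistent L A T"
    and "deductively_complete L A T"
    and "deductively_henkin L A T"
  shows "satisfiable TYPE('u::infinite) L T"
proof -
  interpret henkin_theory L A T using assms by unfold_locales
  \<comment> \<open>Infinity of the type yields room for the countably many closed terms.\<close>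
  obtain g :: "nat \<Rightarrow> 'u" where "inj g"
    using infinite_countable_subset[OF infinite_UNIV] by blast
  then have inj: "inj_on (g \<circ> to_nat_on closed_terms) closed_terms"
    by (rule comp_inj_on[OF inj_on_to_nat_on[OF countable_closed_terms] inj_on_subset]) simp
  have "models (term_model (g \<circ> to_nat_on closed_terms)) \<phi>" if "\<phi> \<in> T" for \<phi>
  proof -
    have s: "is_sentence L A \<phi>" using that assms(5) by (simp add: is_theory_def)
    have "derives L A T \<phi>" using that sentence_wf[OF s] by (rule Hyp)
    then show ?thesis
      using eval_term_model[OF inj s] val_provable[OF s] by (simp add: models_def)
  qed
  then show ?thesis
    unfolding satisfiable_def using is_structure_term_model by blast
qed

end
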